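(* Let $\mathbb{K}$ be a field, $n\geq 2$ and $k\geq 1$ natural numbers, and $p=k(n-1)+1$. If $\mu:\mathcal{L}\to\mathcal{P}$ is a crossed module of Leibniz $n$-algebras over $\mathbb{K}$, then $\mathfrak{U}_n^p(\mu):\mathfrak{U}_n^p(\mathcal{L})\to\mathfrak{U}_n^p(\mathcal{P})$, with the induced action of $\mathfrak{U}_n^p(\mathcal{P})$ on $\mathfrak{U}_n^p(\mathcal{L})$ by iterated brackets, is a crossed module of Leibniz $p$-algebras.
   Context: A Leibniz $n$-algebra over a field $\mathbb{K}$ is a vector space $\mathcal{L}$ with an $n$-linear operation $[-,\dots,-]:\mathcal{L}^{\otimes n}\to\mathcal{L}$ satisfying the fundamental identity \[ [[x_1,\dots,x_n],y_2,\dots,y_n]=\sum_{i=1}^n[x_1,\dots,x_{i-1},[x_i,y_2,\dots,y_n],x_{i+1},\dots,x_n]. \] Homomorphisms are linear maps preserving the bracket. $\mathfrak{U}_n^p$ is the functor sending a Leibniz $n$-algebra $\mathcal{L}$ to the Leibniz $p$-algebra with the same vector space and $p$-ary bracket $[l_1,\dots,l_p]=[l_1,\dots,l_{n-1},[l_n,\dots,l_{2n-2},[\dots,[l_{p-n+1},\dots,l_p]\dots]]]$ ($k$ nested brackets), and acting as the identity on underlying maps. Action: a Leibniz $n$-algebra $\mathcal{P}$ acts on a Leibniz $n$-algebra $\mathcal{L}$ if there are given $2^n-2$ $n$-linear maps $[-,\dots,-]:A_1\otimes\cdots\otimes A_n\to\mathcal{L}$, one for each choice of $A_1,\dots,A_n\in\{\mathcal{L},\mathcal{P}\}$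 in which both $\mathcal{L}$ and $\mathcal{P}$ occur, such that the equalities hold which are obtained from the fundamental identity by taking each of the $2n-1$ variables in $\mathcal{L}$ or $\mathcal{P}$, in all ways in which at least one lies in $\mathcal{L}$ and at least one in $\mathcal{P}$. Induced action: if $\mathcal{P}$ acts on $\mathcal{L}$, then $\mathfrak{U}_n^p(\mathcal{P})$ acts on $\mathfrak{U}_n^p(\mathcal{L})$ by $[x_1,\dots,x_p]=[x_1,\dots,x_{n-1},[x_n,\dots,x_{2n-2},[\dots,[x_{p-n+1},\dots,x_p]\dots]]]$, with $x_i\in\mathcal{L}\cup\mathcal{P}$, both occurring, and each $n$-ary bracket on the right the bracket of $\mathcal{L}$, of $\mathcal{P}$, or an action bracket, according to where its entries lie. Crossed module of Leibniz $n$-algebras: a homomorphism $\mu:\mathcal{L}\to\mathcal{P}$ together with an action of $\mathcal{P}$ on $\mathcal{L}$ such that: (CM1) for every action bracket $[z_1,\dots,z_n]$ (entries from $\mathcal{L}$ and $\mathcal{P}$, both occurring), $\mu[z_1,\dots,z_n]=[z_1',\dots,z_n']$ in $\mathcal{P}$, where $z_i'=\mu(z_i)$ if $z_i\in\mathcal{L}$ and $z_i'=z_i$ if $z_i\in\mathcal{P}$; (CM2) for every $1\le i\le n-1$, the bracket $[l_1,\dots,l_n]$ in $\mathcal{L}$ equals any expression obtained from it by replacing exactly $i$ of the $l$'s by $\mu l$'s; (CM3) any action bracket with at least two entries from $\mathcal{L}$ (and at least one from $\mathcal{P}$) equals any expression obtained from it by replacing exactly one of the entries $l\in\mathcal{L}$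 by $\mu l$. *)

theory Defs
  imports Complex_Main
begin

text \<open>
  An \<open>n\<close>-ary bracket is a function on lists, of which only the values on lists of length
  \<open>n\<close> matter. List positions count from 0, so the fundamental identity reads
  \<open>[[x\<^sub>0,\<dots>,x\<^sub>n\<^sub>-\<^sub>1],ys] = \<Sum>i<n. [x\<^sub>0,\<dots>,[x\<^sub>i,ys],\<dots>,x\<^sub>n\<^sub>-\<^sub>1]\<close> with \<open>ys\<close> of length \<open>n - 1\<close>.
\<close>

locale leibniz_algebra = vector_space scale
  for n :: nat
    and scale :: "'k::field \<Rightarrow> 'a::ab_group_add \<Rightarrow> 'a"
    and br :: "'a list \<Rightarrow> 'a" +
  assumes multilinear:
      "\<And>xs i. length xs = n \<Longrightarrow> i < n \<Longrightarrow> Vector_Spaces.linear scale scale (\<lambda>x. br (xs[i := x]))"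
    and fundamental_identity:
      "\<And>xs ys. length xs = n \<Longrightarrow> length ys = n - 1 \<Longrightarrow>
         br (br xs # ys) = (\<Sum>i<n. br (xs[i := br (xs ! i # ys)]))"

locale leibniz_hom =
  L: leibniz_algebra n scaleL brL + P: leibniz_algebra n scaleP brP
  for n :: nat
    and scaleL :: "'k::field \<Rightarrow> 'l::ab_group_add \<Rightarrow> 'l" and brL :: "'l list \<Rightarrow> 'l"
    and scaleP :: "'k \<Rightarrow> 'p::ab_group_add \<Rightarrow> 'p" and brP :: "'p list \<Rightarrow> 'p"
    and \<mu> :: "'l \<Rightarrow> 'p" +
  assumes linear_hom: "Vector_Spaces.linear scaleL scaleP \<mu>"
    and hom_bracket: "\<And>xs. length xs = n \<Longrightarrow> \<mu> (brL xs) = brP (map \<mu> xs)"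

text \<open>
  Entries from \<open>L\<close> and \<open>P\<close> are tagged by \<open>Inl\<close> and \<open>Inr\<close>. The \<open>2\<^sup>n - 2\<close> action brackets are
  the restrictions of a single function \<open>act\<close> to the mixed lists of length \<open>n\<close> with a fixed
  pattern of tags.
\<close>

definition mixed :: "('l + 'p) list \<Rightarrow> bool" where
  "mixed zs \<longleftrightarrow> (\<exists>z\<in>set zs. isl z) \<and> (\<exists>z\<in>set zs. \<not> isl z)"

text \<open>The bracket of \<open>L\<close>, the bracket of \<open>P\<close> or an action bracket, according to the entries.\<close>

definition mixed_bracket ::
  "('l list \<Rightarrow> 'l) \<Rightarrow> ('p list \<Rightarrow> 'p) \<Rightarrow> (('l + 'p) list \<Rightarrow> 'l) \<Rightarrow> ('l + 'p) list \<Rightarrow> 'l + 'p" where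
  "mixed_bracket brL brP act zs =
     (if mixed zs then Inl (act zs)
      else if \<forall>z\<in>set zs. isl z then Inl (brL (map projl zs))
      else Inr (brP (map projr zs)))"

lemma isl_mixed_bracket:
  "zs \<noteq> [] \<Longrightarrow> isl (mixed_bracket brL brP act zs) \<longleftrightarrow> (\<exists>z\<in>set zs. isl z)"
  by (cases zs) (auto simp: mixed_bracket_def mixed_def)

text \<open>
  The equalities of an action compare elements of \<open>L\<close>: since some variable lies in \<open>L\<close>, every
  outer bracket below carries the tag \<open>Inl\<close> (see lemma \<open>isl_mixed_bracket\<close>), so \<open>projl\<close> is
  only applied where it is meaningful.
\<close>

locale leibniz_action =
  L: leibniz_algebra n scaleL brL + P: leibniz_algebra n scaleP brP
  for n :: nat
    and scaleL :: "'k::field \<Rightarrow> 'l::ab_group_add \<Rightarrow> 'l" and brL :: "'l list \<Rightarrow> 'l"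
    and scaleP :: "'k \<Rightarrow> 'p::ab_group_add \<Rightarrow> 'p" and brP :: "'p list \<Rightarrow> 'p"
    and act :: "('l + 'p) list \<Rightarrow> 'l" +
  assumes action_linear_L:
      "\<And>zs i. length zs = n \<Longrightarrow> mixed zs \<Longrightarrow> i < n \<Longrightarrow> isl (zs ! i) \<Longrightarrow>
         Vector_Spaces.linear scaleL scaleL (\<lambda>l. act (zs[i := Inl l]))"
    and action_linear_P:
      "\<And>zs i. length zs = n \<Longrightarrow> mixed zs \<Longrightarrow> i < n \<Longrightarrow> \<not> isl (zs ! i) \<Longrightarrow>
         Vector_Spaces.linear scaleP scaleL (\<lambda>q. act (zs[i := Inr q]))"
    and action_identity:
      "\<And>xs ys. length xs = n \<Longrightarrow> length ys = n - 1 \<Longrightarrow> mixed (xs @ ys) \<Longrightarrow>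
         projl (mixed_bracket brL brP act (mixed_bracket brL brP act xs # ys)) =
         (\<Sum>i<n. projl (mixed_bracket brL brP act
                           (xs[i := mixed_bracket brL brP act (xs ! i # ys)])))"

definition replace_at :: "('l \<Rightarrow> 'p) \<Rightarrow> nat set \<Rightarrow> 'l list \<Rightarrow> ('l + 'p) list" where
  "replace_at \<mu> I ls = map (\<lambda>j. if j \<in> I then Inr (\<mu> (ls ! j)) else Inl (ls ! j)) [0..<length ls]"

locale leibniz_crossed_module =
  leibniz_hom n scaleL brL scaleP brP \<mu> + leibniz_action n scaleL brL scaleP brP act
  for n :: nat
    and scaleL :: "'k::field \<Rightarrow> 'l::ab_group_add \<Rightarrow> 'l" and brL :: "'l list \<Rightarrow> 'l"
    and scaleP :: "'k \<Rightarrow> 'p::ab_group_add \<Rightarrow> 'p" and brP :: "'p list \<Rightarrow> 'p"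
    and act :: "('l + 'p) list \<Rightarrow> 'l"
    and \<mu> :: "'l \<Rightarrow> 'p" +
  assumes CM1:
      "\<And>zs. length zs = n \<Longrightarrow> mixed zs \<Longrightarrow> \<mu> (act zs) = brP (map (case_sum \<mu> id) zs)"
    and CM2:
      "\<And>ls i I. length ls = n \<Longrightarrow> 1 \<le> i \<Longrightarrow> i \<le> n - 1 \<Longrightarrow> I \<subseteq> {..<n} \<Longrightarrow> card I = i \<Longrightarrow>
         brL ls = act (replace_at \<mu> I ls)"
    and CM3:
      "\<And>zs j l. length zs = n \<Longrightarrow> mixed zs \<Longrightarrow> 2 \<le> length (filter isl zs) \<Longrightarrow>
         j < n \<Longrightarrow> zs ! j = Inl l \<Longrightarrow> act zs = act (zs[j := Inr (\<mu> l)])"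

text \<open>
  \<open>k\<close> nested \<open>n\<close>-ary brackets, applied to a list of length \<open>k * (n - 1) + 1\<close>. On brackets this
  is the functor from Leibniz \<open>n\<close>-algebras to Leibniz \<open>p\<close>-algebras, \<open>p = k * (n - 1) + 1\<close>; the
  underlying vector spaces and maps do not change.
\<close>

primrec nested_bracket :: "nat \<Rightarrow> nat \<Rightarrow> ('a list \<Rightarrow> 'a) \<Rightarrow> 'a list \<Rightarrow> 'a" where
  "nested_bracket n 0 br xs = hd xs"
| "nested_bracket n (Suc k) br xs =
     br (take (n - 1) xs @ [nested_bracket n k br (drop (n - 1) xs)])"

definition induced_action ::
  "nat \<Rightarrow> nat \<Rightarrow> ('l list \<Rightarrow> 'l) \<Rightarrow> ('p list \<Rightarrow> 'p) \<Rightarrow> (('l + 'p) list \<Rightarrow> 'l) \<Rightarrow> ('l + 'p) list \<Rightarrow> 'l"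
where
  "induced_action n k brL brP act zs = projl (nested_bracket n k (mixed_bracket brL brP act) zs)"

end

theory Submission
  imports Defs "HOL-Library.Product_Plus"
begin

text \<open>
  The brackets of \<open>L\<close> and \<open>P\<close> and the action brackets form one operation \<open>M\<close> on tagged elements. Once tagged
  elements are embedded into \<open>L \<times> P\<close>, the axioms of an action together with those of the two
  algebras say that \<open>M\<close> is linear in each entry and that every \<open>x \<mapsto> M (x # ys)\<close> is a derivation of
  \<open>M\<close>. A derivation of \<open>M\<close> is a derivation of the \<open>k\<close>-fold nested bracket, and right
  multiplications of the nested bracket are right multiplications of \<open>M\<close>, so nesting preserves
  these axioms. (CM1) says that \<open>case_sum \<mu> id\<close> is a homomorphism from \<open>M\<close> to the bracket of \<open>P\<close>;
  (CM2) and (CM3) together say that one \<open>L\<close>-entry may be replaced by its image as long as another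
  \<open>L\<close>-entry remains. Both pass to nested brackets by induction on \<open>k\<close>.
\<close>

lemma sum_lessThan_add:
  fixes f :: "nat \<Rightarrow> 'a::comm_monoid_add"
  shows "(\<Sum>i<a + b. f i) = (\<Sum>i<a. f i) + (\<Sum>j<b. f (a + j))"
  by (induction b) (simp_all add: add.assoc)

section \<open>Tagged brackets\<close>

text \<open>Tagged elements cannot be added, so additive identities are stated in the product. The
  two zeros \<open>Inl 0\<close> and \<open>Inr 0\<close> have the same image; tags are therefore
  tracked separately by \<open>isl\<close>.\<close>

fun embed_pair :: "'l::zero + 'p::zero \<Rightarrow> 'l \<times> 'p" where
  "embed_pair (Inl a) = (a, 0)"
| "embed_pair (Inr b) = (0, b)"

definition scale_pair :: "('k \<Rightarrow> 'l \<Rightarrow> 'l) \<Rightarrow> ('k \<Rightarrow> 'p \<Rightarrow> 'p) \<Rightarrow> 'k \<Rightarrow> 'l \<times> 'p \<Rightarrow> 'l \<times> 'p" where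
  "scale_pair s t c v = (s c (fst v), t c (snd v))"

lemma fst_embed_pair: "isl z \<Longrightarrow> fst (embed_pair z) = projl z"
  by (cases z) auto

lemma snd_embed_pair_isl: "isl z \<Longrightarrow> snd (embed_pair z) = 0"
  by (cases z) auto

lemma tagged_list_cases:
  obtains (L) xs where "zs = map Inl xs" | (P) ys where "zs = map Inr ys" | (mixed) "mixed zs"
proof -
  have "zs = map Inl (map projl zs)" if "\<forall>z\<in>set zs. isl z"
    using that by (simp add: map_idI)
  moreover have "zs = map Inr (map projr zs)" if "\<forall>z\<in>set zs. \<not> isl z"
    using that by (simp add: map_idI)
  ultimately show thesis
    using L P mixed unfolding mixed_def by blast
qed

lemma mixed_bracket_Inl: "mixed_bracket brL brP act (map Inl xs) = Inl (brL xs)"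
  by (simp add: mixed_bracket_def mixed_def comp_def)

text \<open>On the empty list, \<open>mixed_bracket\<close> falls into the \<open>L\<close> branch
  because its test holds vacuously; hence the nonemptiness.\<close>

lemma mixed_bracket_Inr: "ys \<noteq> [] \<Longrightarrow> mixed_bracket brL brP act (map Inr ys) = Inr (brP ys)"
  by (cases ys) (simp_all add: mixed_bracket_def mixed_def comp_def)

lemma mixed_bracket_mixed: "mixed zs \<Longrightarrow> mixed_bracket brL brP act zs = Inl (act zs)"
  by (simp add: mixed_bracket_def)

lemma tags_update_eq:
  assumes "i < length zs" "isl z = isl (zs ! i)"
  shows "map isl (zs[i := z]) = map isl zs"
  using assms by (simp add: map_update list_update_same_conv)

lemma mixed_cong: "map isl xs = map isl ys \<Longrightarrow> mixed xs = mixed ys"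
proof -
  have "mixed zs \<longleftrightarrow> True \<in> set (map isl zs) \<and> False \<in> set (map isl zs)" for zs :: "('x + 'y) list"
    by (auto simp: mixed_def)
  then show "map isl xs = map isl ys \<Longrightarrow> mixed xs = mixed ys"
    by metis
qed

text \<open>This allows the derivation identity to be read in \<open>L\<close>, by
  \<open>projl\<close> or by first components. Either \<open>M (xs ! i # ys)\<close> lies in
  \<open>L\<close>, or the \<open>L\<close>-entry stands at another position of \<open>xs\<close>
  and survives the update.\<close>

lemma isl_derivation_terms:
  assumes tag: "\<And>zs. length zs = n \<Longrightarrow> isl (M zs) \<longleftrightarrow> (\<exists>z\<in>set zs. isl z)"
    and len: "length xs = n" "length ys = n - 1"
    and ex: "\<exists>z\<in>set xs \<union> set ys. isl z"
    and n: "0 < n"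
  shows "isl (M (M xs # ys))" "\<And>i. i < n \<Longrightarrow> isl (M (xs[i := M (xs ! i # ys)]))"
proof -
  show "isl (M (M xs # ys))"
    using ex n len by (auto simp: tag)
  fix i assume i: "i < n"
  have "\<exists>z\<in>set (xs[i := M (xs ! i # ys)]). isl z"
  proof (cases "isl (xs ! i) \<or> (\<exists>z\<in>set ys. isl z)")
    case True
    then have "isl (M (xs ! i # ys))" using len n by (auto simp: tag)
    then show ?thesis using i len set_update_memI by metis
  next
    case False
    then obtain j where j: "j < n" "isl (xs ! j)" "j \<noteq> i"
      using ex len by (metis UnE in_set_conv_nth)
    then have "xs[i := M (xs ! i # ys)] ! j = xs ! j" by simp
    then show ?thesis using j len by (metis length_list_update nth_mem)
  qed
  then show "isl (M (xs[i := M (xs ! i # ys)]))" using len by (simp add: tag)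
qed

text \<open>Two algebras with an action, expressed as one operation. Since the tagged type has no
  sums, linearity is relational: it speaks of any \<open>z\<close> whose image is the given
  combination of images, with all three tags equal.\<close>

locale tagged_leibniz = L: vector_space scaleL + P: vector_space scaleP
  for n :: nat
    and scaleL :: "'k::field \<Rightarrow> 'l::ab_group_add \<Rightarrow> 'l"
    and scaleP :: "'k \<Rightarrow> 'p::ab_group_add \<Rightarrow> 'p"
    and M :: "('l + 'p) list \<Rightarrow> 'l + 'p" +
  assumes arity: "2 \<le> n"
    and isl_bracket: "\<And>zs. length zs = n \<Longrightarrow> isl (M zs) \<longleftrightarrow> (\<exists>z\<in>set zs. isl z)"
    and bracket_linear:
      "\<And>zs i z z1 z2 c. length zs = n \<Longrightarrow> i < n \<Longrightarrow> isl z1 = isl z \<Longrightarrow> isl z2 = isl z \<Longrightarrow>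
         embed_pair z = scale_pair scaleL scaleP c (embed_pair z1) + embed_pair z2 \<Longrightarrow>
         embed_pair (M (zs[i := z])) =
           scale_pair scaleL scaleP c (embed_pair (M (zs[i := z1]))) + embed_pair (M (zs[i := z2]))"
    and derivation:
      "\<And>xs ys. length xs = n \<Longrightarrow> length ys = n - 1 \<Longrightarrow>
         embed_pair (M (M xs # ys)) = (\<Sum>i<n. embed_pair (M (xs[i := M (xs ! i # ys)])))"

text \<open>Each axiom splits by tag pattern: lists in \<open>L\<close> alone or \<open>P\<close>
  alone use the axioms of that algebra, mixed lists those of the action.\<close>

lemma (in leibniz_action) tagged_leibniz_mixed_bracket:
  assumes "2 \<le> n"
  shows "tagged_leibniz n scaleL scaleP (mixed_bracket brL brP act)"
proof
  let ?M = "mixed_bracket brL brP act"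
  let ?S = "scale_pair scaleL scaleP"
  show "2 \<le> n" by fact
  show "isl (?M zs) \<longleftrightarrow> (\<exists>z\<in>set zs. isl z)" if "length zs = n" for zs
    using that assms by (intro isl_mixed_bracket) auto
  show "embed_pair (?M (zs[i := z])) = ?S c (embed_pair (?M (zs[i := z1]))) + embed_pair (?M (zs[i := z2]))"
    if len: "length zs = n" and i: "i < n" and tags: "isl z1 = isl z" "isl z2 = isl z"
      and z: "embed_pair z = ?S c (embed_pair z1) + embed_pair z2" for zs i z z1 z2 c
  proof -
    \<comment> \<open>The entry \<open>zs ! i\<close> is overwritten and may carry either tag, so
      the tag pattern is read off after inserting \<open>z\<close>.\<close>
    define ws where "ws = zs[i := z]"
    have lenw: "length ws = n" and wsi: "ws ! i = z"
      using len i by (simp_all add: ws_def)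
    have upd: "zs[i := x] = ws[i := x]" for x
      by (simp add: ws_def)
    have ne: "ws \<noteq> []" using lenw assms by auto
    show ?thesis
    proof (cases ws rule: tagged_list_cases)
      case (L xs)
      then obtain a where a: "z = Inl a" using wsi lenw i by auto
      then obtain a1 a2 where a12: "z1 = Inl a1" "z2 = Inl a2"
        using tags by (metis isl_def)
      have aa: "a = scaleL c a1 + a2" using z by (simp add: a a12 scale_pair_def)
      have M: "?M (zs[i := Inl x]) = Inl (brL (xs[i := x]))" for x
        unfolding upd L by (simp add: mixed_bracket_Inl flip: map_update)
      have "Vector_Spaces.linear scaleL scaleL (\<lambda>x. brL (xs[i := x]))"
        using L lenw i by (intro L.multilinear) auto
      then show ?thesis
        by (simp add: a a12 aa M scale_pair_def P.scale_zero_right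
            Vector_Spaces.linear_iff)
    next
      case (P ys)
      then obtain b where b: "z = Inr b" using wsi lenw i by auto
      then obtain b1 b2 where b12: "z1 = Inr b1" "z2 = Inr b2"
        using tags by (metis isl_def sum.exhaust sum.disc(2))
      have bb: "b = scaleP c b1 + b2" using z by (simp add: b b12 scale_pair_def)
      have M: "?M (zs[i := Inr x]) = Inr (brP (ys[i := x]))" for x
        unfolding upd P using ne P by (simp add: mixed_bracket_Inr flip: map_update)
      have "Vector_Spaces.linear scaleP scaleP (\<lambda>x. brP (ys[i := x]))"
        using P lenw i by (intro P.multilinear) auto
      then show ?thesis
        by (simp add: b b12 bb M scale_pair_def L.scale_zero_right
            Vector_Spaces.linear_iff)
    next
      case mixed
      have M: "?M (zs[i := x]) = Inl (act (ws[i := x]))" if "isl x = isl z" for x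
      proof -
        have "mixed (ws[i := x])"
          using mixed mixed_cong[OF tags_update_eq] lenw i that wsi by blast
        then show ?thesis by (simp add: upd mixed_bracket_mixed)
      qed
      show ?thesis
      proof (cases z)
        case (Inl a)
        then obtain a1 a2 where a12: "z1 = Inl a1" "z2 = Inl a2"
          using tags by (metis isl_def)
        have aa: "a = scaleL c a1 + a2" using z by (simp add: Inl a12 scale_pair_def)
        have "Vector_Spaces.linear scaleL scaleL (\<lambda>x. act (ws[i := Inl x]))"
          using mixed lenw i wsi Inl by (intro action_linear_L) auto
        then show ?thesis
          by (simp add: M Inl a12 aa scale_pair_def P.scale_zero_right Vector_Spaces.linear_iff)
      next
        case (Inr b)
        then obtain b1 b2 where b12: "z1 = Inr b1" "z2 = Inr b2"
          using tags by (metis isl_def sum.exhaust sum.disc(2))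
        have bb: "b = scaleP c b1 + b2" using z by (simp add: Inr b12 scale_pair_def)
        have "Vector_Spaces.linear scaleP scaleL (\<lambda>x. act (ws[i := Inr x]))"
          using mixed lenw i wsi Inr by (intro action_linear_P) auto
        then show ?thesis
          by (simp add: M Inr b12 bb scale_pair_def P.scale_zero_right Vector_Spaces.linear_iff)
      qed
    qed
  qed
  show "embed_pair (?M (?M xs # ys)) = (\<Sum>i<n. embed_pair (?M (xs[i := ?M (xs ! i # ys)])))"
    if len: "length xs = n" "length ys = n - 1" for xs ys
  proof -
    have ne: "xs \<noteq> []" using len assms by auto
    show ?thesis
    proof (cases "xs @ ys" rule: tagged_list_cases)
      case (L zs)
      then obtain us vs where uv: "xs = map Inl us" "ys = map Inl vs"
        by (metis append_eq_map_conv)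
      have "embed_pair (?M (xs[i := ?M (xs ! i # ys)])) = (brL (us[i := brL (us ! i # vs)]), 0)"
        if "i < n" for i
        using that len unfolding uv
        by (simp add: mixed_bracket_Inl flip: map_update list.map(2))
      moreover have "embed_pair (?M (?M xs # ys)) = (brL (brL us # vs), 0)"
        unfolding uv by (simp add: mixed_bracket_Inl flip: list.map(2))
      ultimately show ?thesis
        using L.fundamental_identity[of us vs] len uv by (simp add: prod_eq_iff fst_sum snd_sum)
    next
      case (P zs)
      then obtain us vs where uv: "xs = map Inr us" "ys = map Inr vs"
        by (metis append_eq_map_conv)
      have "embed_pair (?M (xs[i := ?M (xs ! i # ys)])) = (0, brP (us[i := brP (us ! i # vs)]))"
        if "i < n" for i
        using that len ne unfolding uv
        by (simp add: mixed_bracket_Inr flip: map_update list.map(2))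
      moreover have "embed_pair (?M (?M xs # ys)) = (0, brP (brP us # vs))"
        using ne unfolding uv by (simp add: mixed_bracket_Inr flip: list.map(2))
      ultimately show ?thesis
        using P.fundamental_identity[of us vs] len uv by (simp add: prod_eq_iff fst_sum snd_sum)
    next
      case mixed
      then have ex: "\<exists>z\<in>set xs \<union> set ys. isl z" by (auto simp: mixed_def)
      have tag: "isl (?M zs) \<longleftrightarrow> (\<exists>z\<in>set zs. isl z)" if "length zs = n" for zs
        using that assms by (intro isl_mixed_bracket) auto
      \<comment> \<open>The action identity gives equality of first components; the second
        components vanish because every term is tagged \<open>Inl\<close>.\<close>
      show ?thesis
        using action_identity[OF len mixed] isl_derivation_terms[of n ?M, OF tag len ex] assms
        by (simp add: prod_eq_iff fst_sum snd_sum fst_embed_pair snd_embed_pair_isl)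
    qed
  qed
qed

section \<open>From the tagged operation back to algebras and an action\<close>

lemma linear_if_preserves_combination:
  assumes "vector_space s" "vector_space t"
    and comb: "\<And>c x y. f (s c x + y) = t c (f x) + f y"
  shows "Vector_Spaces.linear s t f"
proof -
  interpret s: vector_space s by fact
  interpret t: vector_space t by fact
  have add: "f (x + y) = f x + f y" for x y
    using comb[of 1 x y] by simp
  then have "f 0 = 0" by (metis add_cancel_right_left add.right_neutral)
  then have "f (s c x) = t c (f x)" for c x
    using comb[of c x 0] by simp
  then show ?thesis
    using add assms by (simp add: Vector_Spaces.linear_iff)
qed

text \<open>The axioms of \<open>L\<close> and \<open>P\<close> are recovered by evaluating on lists
  with constant tag and projecting to the matching coordinate; mixed lists give those of the
  action.\<close>

lemma leibniz_action_if_tagged_leibniz: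
  fixes scaleL :: "'k::field \<Rightarrow> 'l::ab_group_add \<Rightarrow> 'l"
    and scaleP :: "'k \<Rightarrow> 'p::ab_group_add \<Rightarrow> 'p"
  assumes "tagged_leibniz n scaleL scaleP (mixed_bracket brL brP act)"
  shows "leibniz_action n scaleL brL scaleP brP act"
proof -
  let ?M = "mixed_bracket brL brP act"
  let ?S = "scale_pair scaleL scaleP"
  interpret tagged_leibniz n scaleL scaleP ?M by fact
  note vs = L.vector_space_axioms P.vector_space_axioms
  have n: "n \<noteq> 0" using arity by simp
  have lin: "embed_pair (?M (zs[i := z])) = ?S c (embed_pair (?M (zs[i := z1]))) + embed_pair (?M (zs[i := z2]))"
    if "length zs = n" "i < n" "isl z1 = isl z" "isl z2 = isl z"
      "embed_pair z = ?S c (embed_pair z1) + embed_pair z2" for zs i z z1 z2 c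
    using that by (rule bracket_linear)
  have mixed_update: "mixed (zs[i := z])"
    if "mixed zs" "i < length zs" "isl z = isl (zs ! i)" for zs :: "('l + 'p) list" and i z
    using that mixed_cong[OF tags_update_eq] by blast
  \<comment> \<open>A combination formed inside \<open>L\<close> or \<open>P\<close> satisfies the
    relational premise of \<open>lin\<close>.\<close>
  have embL: "embed_pair (Inl (scaleL c x + y)) = ?S c (embed_pair (Inl x)) + embed_pair (Inl y)"
    and embP: "embed_pair (Inr (scaleP c x' + y')) = ?S c (embed_pair (Inr x')) + embed_pair (Inr y')"
    for c x y x' y'
    by (simp_all add: scale_pair_def)
  show ?thesis
  proof (intro leibniz_action.intro leibniz_algebra.intro leibniz_algebra_axioms.intro
      leibniz_action_axioms.intro vs)
    show "Vector_Spaces.linear scaleL scaleL (\<lambda>x. brL (xs[i := x]))"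
      if "length xs = n" "i < n" for xs i
    proof (rule linear_if_preserves_combination[OF vs(1) vs(1)])
      fix c x y
      show "brL (xs[i := scaleL c x + y]) = scaleL c (brL (xs[i := x])) + brL (xs[i := y])"
        using lin[OF _ _ _ _ embL, of "map Inl xs" i x c y] that
        by (simp add: mixed_bracket_Inl scale_pair_def flip: map_update)
    qed
    show "Vector_Spaces.linear scaleP scaleP (\<lambda>x. brP (xs[i := x]))"
      if "length xs = n" "i < n" for xs i
    proof (rule linear_if_preserves_combination[OF vs(2) vs(2)])
      fix c x y
      have ne: "xs[i := z] \<noteq> []" for z using that n by auto
      show "brP (xs[i := scaleP c x + y]) = scaleP c (brP (xs[i := x])) + brP (xs[i := y])"
        using lin[OF _ _ _ _ embP, of "map Inr xs" i x c y] that ne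
        by (simp add: mixed_bracket_Inr scale_pair_def del: list_update_nonempty flip: map_update)
    qed
    show "Vector_Spaces.linear scaleL scaleL (\<lambda>x. act (zs[i := Inl x]))"
      if "length zs = n" "mixed zs" "i < n" "isl (zs ! i)" for zs i
    proof (rule linear_if_preserves_combination[OF vs(1) vs(1)])
      fix c x y
      show "act (zs[i := Inl (scaleL c x + y)]) =
        scaleL c (act (zs[i := Inl x])) + act (zs[i := Inl y])"
        using lin[OF _ _ _ _ embL, of zs i x c y] that
        by (simp add: mixed_bracket_mixed mixed_update scale_pair_def)
    qed
    show "Vector_Spaces.linear scaleP scaleL (\<lambda>x. act (zs[i := Inr x]))"
      if "length zs = n" "mixed zs" "i < n" "\<not> isl (zs ! i)" for zs i
    proof (rule linear_if_preserves_combination[OF vs(2) vs(1)])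
      fix c x y
      show "act (zs[i := Inr (scaleP c x + y)]) =
        scaleL c (act (zs[i := Inr x])) + act (zs[i := Inr y])"
        using lin[OF _ _ _ _ embP, of zs i x c y] that
        by (simp add: mixed_bracket_mixed mixed_update scale_pair_def)
    qed
    show "brL (brL xs # ys) = (\<Sum>i<n. brL (xs[i := brL (xs ! i # ys)]))"
      if len: "length xs = n" "length ys = n - 1" for xs ys
    proof -
      have "fst (embed_pair (?M ((map Inl xs)[i := ?M (map Inl xs ! i # map Inl ys)]))) =
        brL (xs[i := brL (xs ! i # ys)])" if "i < n" for i
        using that len by (simp add: mixed_bracket_Inl flip: map_update list.map(2))
      moreover have "embed_pair (?M (?M (map Inl xs) # map Inl ys)) = (brL (brL xs # ys), 0)"
        by (simp add: mixed_bracket_Inl flip: list.map(2))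
      ultimately show ?thesis
        using derivation[of "map Inl xs" "map Inl ys"] len
        by (simp add: prod_eq_iff fst_sum)
    qed
    show "brP (brP xs # ys) = (\<Sum>i<n. brP (xs[i := brP (xs ! i # ys)]))"
      if len: "length xs = n" "length ys = n - 1" for xs ys
    proof -
      have ne: "xs \<noteq> []" using len n by auto
      have "snd (embed_pair (?M ((map Inr xs)[i := ?M (map Inr xs ! i # map Inr ys)]))) =
        brP (xs[i := brP (xs ! i # ys)])" if "i < n" for i
        using that len ne by (simp add: mixed_bracket_Inr flip: map_update list.map(2))
      moreover have "embed_pair (?M (?M (map Inr xs) # map Inr ys)) = (0, brP (brP xs # ys))"
        using ne by (simp add: mixed_bracket_Inr flip: list.map(2))
      ultimately show ?thesis
        using derivation[of "map Inr xs" "map Inr ys"] len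
        by (simp add: prod_eq_iff snd_sum)
    qed
    show "projl (?M (?M xs # ys)) = (\<Sum>i<n. projl (?M (xs[i := ?M (xs ! i # ys)])))"
      if len: "length xs = n" "length ys = n - 1" and mixed: "mixed (xs @ ys)" for xs ys
    proof -
      have "\<exists>z\<in>set xs \<union> set ys. isl z" using mixed by (auto simp: mixed_def)
      then show ?thesis
        using derivation[OF len] isl_derivation_terms[of n ?M, OF isl_bracket len] arity
        by (simp add: prod_eq_iff fst_sum fst_embed_pair)
    qed
  qed
qed

section \<open>Nested brackets\<close>

text \<open>On a list already split after \<open>n - 1\<close> entries the recursion needs no
  \<open>take\<close> or \<open>drop\<close>. This form replaces the defining equation as the
  simplification rule.\<close>

lemma nested_bracket_append:
  "length us = n - 1 \<Longrightarrow>
    nested_bracket n (Suc k) br (us @ vs) = br (us @ [nested_bracket n k br vs])"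
  by simp

lemma nested_bracket_split:
  assumes "length zs = Suc k * (n - 1) + 1"
  obtains us vs where "zs = us @ vs" "length us = n - 1" "length vs = k * (n - 1) + 1"
  using assms by (intro that[of "take (n - 1) zs" "drop (n - 1) zs"]) auto

declare nested_bracket.simps(2) [simp del] nested_bracket_append [simp]

text \<open>Functoriality of nesting. It serves for the injections \<open>Inl\<close> and
  \<open>Inr\<close> and for \<open>case_sum \<mu> id\<close>.\<close>

lemma nested_bracket_map:
  assumes "2 \<le> n" and hom: "\<And>xs. length xs = n \<Longrightarrow> f (b xs) = b' (map f xs)"
    and "length xs = k * (n - 1) + 1"
  shows "f (nested_bracket n k b xs) = nested_bracket n k b' (map f xs)"
  using assms(3)
proof (induction k arbitrary: xs)
  case 0
  then show ?case by (cases xs) simp_all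
next
  case (Suc k)
  obtain us vs where xs: "xs = us @ vs" "length us = n - 1" "length vs = k * (n - 1) + 1"
    using nested_bracket_split[OF Suc.prems] .
  have "f (nested_bracket n (Suc k) b xs) = b' (map f us @ [f (nested_bracket n k b vs)])"
    using xs assms(1) by (simp add: hom)
  also have "\<dots> = nested_bracket n (Suc k) b' (map f xs)"
    using xs by (simp add: Suc.IH)
  finally show ?case .
qed

section \<open>Linearity and derivations under nesting\<close>

context tagged_leibniz
begin

abbreviation "S \<equiv> scale_pair scaleL scaleP"
abbreviation "N k \<equiv> nested_bracket n k M"

lemma isl_nested_bracket:
  "length zs = k * (n - 1) + 1 \<Longrightarrow> isl (N k zs) \<longleftrightarrow> (\<exists>z\<in>set zs. isl z)"
proof (induction k arbitrary: zs)
  case 0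
  then show ?case by (cases zs) simp_all
next
  case (Suc k)
  obtain us vs where zs: "zs = us @ vs" "length us = n - 1" "length vs = k * (n - 1) + 1"
    using nested_bracket_split[OF Suc.prems] .
  have "isl (N (Suc k) zs) \<longleftrightarrow> (\<exists>z\<in>set (us @ [N k vs]). isl z)"
    using zs arity by (simp add: isl_bracket)
  also have "\<dots> \<longleftrightarrow> (\<exists>z\<in>set zs. isl z)"
    using zs by (auto simp: Suc.IH)
  finally show ?case .
qed

lemma isl_nested_bracket_update:
  assumes "length zs = k * (n - 1) + 1" "i < length zs" "isl z1 = isl z2"
  shows "isl (N k (zs[i := z1])) = isl (N k (zs[i := z2]))"
proof -
  have "(\<exists>z\<in>set (zs[i := z1]). isl z) \<longleftrightarrow> (\<exists>z\<in>set (zs[i := z2]). isl z)"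
    using assms by (simp add: upd_conv_take_nth_drop bex_Un)
  then show ?thesis
    using assms by (simp add: isl_nested_bracket)
qed

text \<open>Every entry occurs once, either directly in the outer bracket or inside its last
  argument, so a composition of linear maps results.\<close>

lemma nested_bracket_linear:
  assumes "length zs = k * (n - 1) + 1" "i < k * (n - 1) + 1" "isl z1 = isl z" "isl z2 = isl z"
    and "embed_pair z = S c (embed_pair z1) + embed_pair z2"
  shows "embed_pair (N k (zs[i := z])) =
    S c (embed_pair (N k (zs[i := z1]))) + embed_pair (N k (zs[i := z2]))"
  using assms(1,2)
proof (induction k arbitrary: zs i)
  case 0
  then show ?case using assms by (cases zs) simp_all
next
  case (Suc k)
  obtain us vs where zs: "zs = us @ vs" "length us = n - 1" "length vs = k * (n - 1) + 1"
    using nested_bracket_split[OF Suc.prems(1)] .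
  show ?case
  proof (cases "i < n - 1")
    case True
    then have "N (Suc k) (zs[i := x]) = M ((us @ [N k vs])[i := x])" for x
      using zs by (simp add: list_update_append)
    then show ?thesis
      using bracket_linear[OF _ _ assms(3-5), of "us @ [N k vs]" i] True zs arity by simp
  next
    case False
    define j where "j = i - (n - 1)"
    have j: "j < k * (n - 1) + 1" using False Suc.prems(2) by (auto simp: j_def)
    \<comment> \<open>The inner bracket is presented as an update of position \<open>n - 1\<close>,
      the form \<open>bracket_linear\<close> expects; \<open>undefined\<close> is a placeholder that
      is always overwritten.\<close>
    have upd: "N (Suc k) (zs[i := x]) = M ((us @ [undefined])[n - 1 := N k (vs[j := x])])" for x
      using zs False by (simp add: list_update_append j_def)
    have tags: "isl (N k (vs[j := z1])) = isl (N k (vs[j := z]))"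
      "isl (N k (vs[j := z2])) = isl (N k (vs[j := z]))"
      using zs(3) j assms(3,4) by (intro isl_nested_bracket_update; simp)+
    show ?thesis
      unfolding upd using zs(2) arity
      by (intro bracket_linear[OF _ _ tags Suc.IH[OF zs(3) j]]) simp_all
  qed
qed

lemma bracket_sum:
  assumes len: "length zs = n" "i < n" and "finite J"
    and "\<And>j. j \<in> J \<Longrightarrow> isl (f j) = isl z"
    and "embed_pair z = (\<Sum>j\<in>J. embed_pair (f j))"
  shows "embed_pair (M (zs[i := z])) = (\<Sum>j\<in>J. embed_pair (M (zs[i := f j])))"
  using assms(3-5)
proof (induction J arbitrary: z rule: finite_induct)
  case empty
  \<comment> \<open>Here \<open>z\<close> has image 0, and 0 = 0 + 0 forces the image
    \<open>v\<close> of the bracket to satisfy \<open>v = v + v\<close>.\<close>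
  have "embed_pair z = S 1 (embed_pair z) + embed_pair z"
    using empty by (simp add: scale_pair_def zero_prod_def)
  from bracket_linear[OF len _ _ this] show ?case
    by (simp add: scale_pair_def prod_eq_iff)
next
  case (insert a J)
  \<comment> \<open>A tagged representative of the partial sum. It exists because all
    \<open>f j\<close> share the tag of \<open>z\<close>, so the other coordinate of the sum is
    zero.\<close>
  define s where "s = (if isl z then Inl (fst (\<Sum>j\<in>J. embed_pair (f j)))
    else Inr (snd (\<Sum>j\<in>J. embed_pair (f j))))"
  have tag: "isl s = isl z" by (simp add: s_def)
  have "fst (embed_pair (f j)) = 0" if "j \<in> J" "\<not> isl z" for j
    using insert.prems(1)[of j] that by (cases "f j") auto
  moreover have "snd (embed_pair (f j)) = 0" if "j \<in> J" "isl z" for j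
    using insert.prems(1)[of j] that by (cases "f j") auto
  ultimately have s: "embed_pair s = (\<Sum>j\<in>J. embed_pair (f j))"
    by (simp add: s_def prod_eq_iff fst_sum snd_sum)
  have "embed_pair z = S 1 (embed_pair (f a)) + embed_pair s"
    using insert by (simp add: scale_pair_def s)
  from bracket_linear[OF len _ tag this]
  have "embed_pair (M (zs[i := z])) = embed_pair (M (zs[i := f a])) + embed_pair (M (zs[i := s]))"
    using insert.prems(1) by (simp add: scale_pair_def)
  also have "embed_pair (M (zs[i := s])) = (\<Sum>j\<in>J. embed_pair (M (zs[i := f j])))"
    using insert.prems(1) tag s by (intro insert.IH) auto
  finally show ?case using insert.hyps by simp
qed

text \<open>Induction on \<open>k\<close>: the derivation acts on the \<open>n - 1\<close> outer
  entries and on the inner bracket, and \<open>bracket_sum\<close> distributes the outer bracket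
  over the sum that the induction hypothesis gives for the latter.\<close>

lemma nested_bracket_derivation:
  assumes ws: "length ws = n - 1" and "length zs = k * (n - 1) + 1"
  shows "embed_pair (M (N k zs # ws)) =
    (\<Sum>i<k * (n - 1) + 1. embed_pair (N k (zs[i := M (zs ! i # ws)])))"
  using assms(2)
proof (induction k arbitrary: zs)
  case 0
  then show ?case by (cases zs) simp_all
next
  case (Suc k)
  let ?D = "\<lambda>z. M (z # ws)"
  obtain us vs where zs: "zs = us @ vs" "length us = n - 1" "length vs = k * (n - 1) + 1"
    using nested_bracket_split[OF Suc.prems] .
  let ?us = "us @ [N k vs]"
  have n: "n = n - 1 + 1" using arity by simp
  have len: "length ?us = n" using zs arity by simp
  \<comment> \<open>The tag condition of \<open>bracket_sum\<close>: both sides lie in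
    \<open>L\<close> exactly when some entry of \<open>vs\<close> or \<open>ws\<close> does.\<close>
  have tags: "isl (N k (vs[j := ?D (vs ! j)])) = isl (?D (N k vs))"
    if "j < k * (n - 1) + 1" for j
  proof -
    have "isl (?D (N k vs)) \<longleftrightarrow> (\<exists>z\<in>set vs \<union> set ws. isl z)"
      using ws zs arity by (auto simp: isl_bracket isl_nested_bracket)
    moreover have "isl (?D (vs ! j)) \<longleftrightarrow> isl (vs ! j) \<or> (\<exists>z\<in>set ws. isl z)"
      using ws arity by (simp add: isl_bracket)
    moreover have "vs = take j vs @ vs ! j # drop (Suc j) vs"
      using that zs by (simp add: id_take_nth_drop)
    then have "set vs = insert (vs ! j) (set (take j vs) \<union> set (drop (Suc j) vs))"
      by (metis Un_insert_right list.simps(15) set_append)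
    ultimately show ?thesis
      using that zs by (auto simp: isl_nested_bracket upd_conv_take_nth_drop)
  qed
  have "embed_pair (?D (N (Suc k) zs)) = (\<Sum>i<n. embed_pair (M (?us[i := ?D (?us ! i)])))"
    using derivation[OF len ws] zs by simp
  also have "\<dots> = (\<Sum>i<n - 1. embed_pair (M (?us[i := ?D (?us ! i)]))) +
      embed_pair (M (?us[n - 1 := ?D (N k vs)]))"
    using zs by (subst (1) n) (simp add: nth_append)
  also have "(\<Sum>i<n - 1. embed_pair (M (?us[i := ?D (?us ! i)]))) =
      (\<Sum>i<n - 1. embed_pair (N (Suc k) (zs[i := ?D (zs ! i)])))"
    using zs by (intro sum.cong) (auto simp: nth_append list_update_append)
  also have "embed_pair (M (?us[n - 1 := ?D (N k vs)])) =
      (\<Sum>j<k * (n - 1) + 1. embed_pair (M (?us[n - 1 := N k (vs[j := ?D (vs ! j)])])))"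
    using len arity tags Suc.IH[OF zs(3)] by (intro bracket_sum) auto
  also have "\<dots> =
      (\<Sum>j<k * (n - 1) + 1. embed_pair (N (Suc k) (zs[n - 1 + j := ?D (zs ! (n - 1 + j))])))"
    using zs by (intro sum.cong) (auto simp: nth_append list_update_append)
  \<comment> \<open>The index range splits into \<open>n - 1\<close> outer positions followed by
    \<open>k * (n - 1) + 1\<close> inner ones.\<close>
  finally show ?case
    unfolding mult_Suc add.assoc sum_lessThan_add .
qed

text \<open>As \<open>k \<ge> 1\<close>, the first argument stands directly in the outermost
  bracket, so right multiplications of the nested bracket are right multiplications of
  \<open>M\<close>. Agreement of \<open>M'\<close> with \<open>N k\<close> is asked only on lists of
  length \<open>p\<close>, where the induced bracket provides it.\<close>

lemma tagged_leibniz_nested_bracket: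
  assumes "1 \<le> k" "p = k * (n - 1) + 1"
    and M': "\<And>zs. length zs = p \<Longrightarrow> M' zs = N k zs"
  shows "tagged_leibniz p scaleL scaleP M'"
proof
  show "2 \<le> p" using assms(1,2) arity by (cases k) auto
  show "isl (M' zs) \<longleftrightarrow> (\<exists>z\<in>set zs. isl z)" if "length zs = p" for zs
    using that by (simp add: M' isl_nested_bracket assms(2))
  show "embed_pair (M' (zs[i := z])) =
      S c (embed_pair (M' (zs[i := z1]))) + embed_pair (M' (zs[i := z2]))"
    if "length zs = p" "i < p" "isl z1 = isl z" "isl z2 = isl z"
      "embed_pair z = S c (embed_pair z1) + embed_pair z2" for zs i z z1 z2 c
    using that nested_bracket_linear[OF _ _ that(3-5)] by (simp add: M' assms(2))
  show "embed_pair (M' (M' xs # ys)) = (\<Sum>i<p. embed_pair (M' (xs[i := M' (xs ! i # ys)])))"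
    if len: "length xs = p" "length ys = p - 1" for xs ys
  proof -
    obtain k' where k: "k = Suc k'" using assms(1) by (cases k) auto
    \<comment> \<open>The other arguments of the outermost bracket: \<open>n - 2\<close> plain
      entries, one position being taken by \<open>z\<close>, and the inner bracket.\<close>
    define ws where "ws = take (n - 2) ys @ [N k' (drop (n - 2) ys)]"
    have ws: "length ws = n - 1"
      using len assms(2) arity k by (simp add: ws_def)
    have M'_Cons: "M' (z # ys) = M (z # ws)" for z
    proof -
      have "n - 1 = Suc (n - 2)" using arity by simp
      then have "N k (z # ys) = M (z # ws)" by (simp add: k ws_def nested_bracket.simps(2))
      then show ?thesis using len assms(2) by (simp add: M')
    qed
    show ?thesis
      unfolding M'_Cons using nested_bracket_derivation[OF ws, of xs k] len
      by (simp add: M' assms(2))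
  qed
qed

end

text \<open>Forming the tagged operation commutes with nesting. On lists with constant tag the
  injections are homomorphisms; on mixed lists the nested bracket is tagged \<open>Inl\<close>, so
  \<open>projl\<close> loses nothing.\<close>

lemma mixed_bracket_induced_action:
  assumes "tagged_leibniz n scaleL scaleP (mixed_bracket brL brP act)"
    and "length zs = k * (n - 1) + 1"
  shows "mixed_bracket (nested_bracket n k brL) (nested_bracket n k brP)
      (induced_action n k brL brP act) zs = nested_bracket n k (mixed_bracket brL brP act) zs"
proof -
  interpret tagged_leibniz n scaleL scaleP "mixed_bracket brL brP act" by fact
  show ?thesis
  proof (cases zs rule: tagged_list_cases)
    case (L xs)
    then show ?thesis
      using nested_bracket_map[of n Inl brL "mixed_bracket brL brP act" xs k] assms(2) arity
      by (simp add: mixed_bracket_Inl)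
  next
    case (P ys)
    moreover from this have "ys \<noteq> []" using assms(2) by auto
    moreover have "Inr (brP us) = mixed_bracket brL brP act (map Inr us)" if "length us = n" for us
      using that arity by (subst mixed_bracket_Inr) auto
    ultimately show ?thesis
      using nested_bracket_map[of n Inr brP "mixed_bracket brL brP act" ys k] assms(2) arity
      by (simp add: mixed_bracket_Inr)
  next
    case mixed
    then have "isl (nested_bracket n k (mixed_bracket brL brP act) zs)"
      using assms(2) by (auto simp: isl_nested_bracket mixed_def)
    then show ?thesis
      using mixed by (simp add: mixed_bracket_mixed induced_action_def)
  qed
qed

section \<open>Crossed modules\<close>

text \<open>Translates the counting condition of (CM3) into a second \<open>L\<close>-position, the
  form used in the induction on nesting.\<close>

lemma two_isl_iff:
  assumes "j < length zs" "isl (zs ! j)"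
  shows "2 \<le> length (filter isl zs) \<longleftrightarrow> (\<exists>i<length zs. i \<noteq> j \<and> isl (zs ! i))"
proof -
  let ?A = "{i. i < length zs \<and> isl (zs ! i)}"
  have "2 \<le> length (filter isl zs) \<longleftrightarrow> 1 \<le> card (?A - {j})"
    using assms by (auto simp: length_filter_conv_card)
  also have "\<dots> \<longleftrightarrow> ?A - {j} \<noteq> {}"
    by (simp add: card_gt_0_iff Suc_le_eq)
  finally show ?thesis by auto
qed

lemma mixed_replace:
  assumes "j < length zs" "i < length zs" "i \<noteq> j" "isl (zs ! i)" "\<not> isl x"
  shows "mixed (zs[j := x])"
proof -
  have "zs[j := x] ! i \<in> set (zs[j := x])" "x \<in> set (zs[j := x])"
    using assms by (auto intro!: nth_mem set_update_memI simp del: nth_list_update_neq)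
  then show ?thesis using assms unfolding mixed_def by force
qed

section \<open>The crossed module axioms for the tagged operation\<close>

context leibniz_crossed_module
begin

text \<open>The homomorphism property of \<open>\<mu>\<close> covers lists in \<open>L\<close>,
  (CM1) covers mixed lists, and on lists in \<open>P\<close> the map is the identity.\<close>

lemma hom_mixed_bracket:
  assumes "length zs = n" "2 \<le> n"
  shows "case_sum \<mu> id (mixed_bracket brL brP act zs) = brP (map (case_sum \<mu> id) zs)"
proof (cases zs rule: tagged_list_cases)
  case (L xs)
  then show ?thesis using assms by (simp add: mixed_bracket_Inl hom_bracket comp_def)
next
  case (P ys)
  moreover from this have "ys \<noteq> []" using assms by auto
  ultimately show ?thesis by (simp add: mixed_bracket_Inr comp_def)
next
  case mixed
  then show ?thesis using assms by (simp add: mixed_bracket_mixed CM1)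
qed

text \<open>For a list in \<open>L\<close> this is (CM2) with \<open>I = {j}\<close>, for a mixed
  list (CM3). The entry at \<open>i\<close> keeps the result in \<open>L\<close>.\<close>

lemma mixed_bracket_replace:
  assumes len: "length zs = n" and j: "j < n" "zs ! j = Inl l"
    and i: "i < n" "i \<noteq> j" "isl (zs ! i)"
  shows "mixed_bracket brL brP act zs = mixed_bracket brL brP act (zs[j := Inr (\<mu> l)])"
proof -
  have mixed': "mixed (zs[j := Inr (\<mu> l)])"
    using len j i by (intro mixed_replace) auto
  show ?thesis
  proof (cases zs rule: tagged_list_cases)
    case (L xs)
    have "replace_at \<mu> {j} xs = zs[j := Inr (\<mu> l)]"
      using len j unfolding L by (intro nth_equalityI) (auto simp: replace_at_def nth_list_update)
    moreover have "brL xs = act (replace_at \<mu> {j} xs)"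
      using L len j i by (intro CM2[of _ 1]) auto
    ultimately show ?thesis
      using L mixed' by (simp add: mixed_bracket_Inl mixed_bracket_mixed)
  next
    case (P ys)
    then show ?thesis using j len by auto
  next
    case mixed
    have "2 \<le> length (filter isl zs)"
      using len i j by (subst two_isl_iff[of j]) auto
    then show ?thesis
      using CM3[OF len mixed _ j] mixed mixed' by (simp add: mixed_bracket_mixed)
  qed
qed

text \<open>The delicate case is that the replaced entry is the only \<open>L\<close>-entry of the
  inner bracket. Then the inner value moves from some \<open>a\<close> in \<open>L\<close> to
  \<open>\<mu> a\<close> in \<open>P\<close>, which is itself a replacement in the outer
  bracket.\<close>

lemma nested_mixed_bracket_replace:
  assumes "2 \<le> n"
    and "length zs = k * (n - 1) + 1" and "j < length zs" "zs ! j = Inl l"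
    and "i < length zs" "i \<noteq> j" "isl (zs ! i)"
  defines "M \<equiv> mixed_bracket brL brP act"
  shows "nested_bracket n k M zs = nested_bracket n k M (zs[j := Inr (\<mu> l)])"
  using assms(2-7)
proof (induction k arbitrary: zs i j)
  case 0
  then show ?case by simp
next
  case (Suc k)
  interpret tagged_leibniz n scaleL scaleP M
    unfolding M_def using assms(1) by (rule tagged_leibniz_mixed_bracket)
  obtain us vs where zs: "zs = us @ vs" "length us = n - 1" "length vs = k * (n - 1) + 1"
    using nested_bracket_split[OF Suc.prems(1)] .
  show ?case
  proof (cases "j < n - 1")
    case True
    \<comment> \<open>The remaining \<open>L\<close>-entry of the outer bracket is the one at
      \<open>i\<close>, or the inner bracket if position \<open>i\<close> lies inside it.\<close>
    obtain i' where i': "i' < n" "i' \<noteq> j" "isl ((us @ [N k vs]) ! i')"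
    proof (cases "i < n - 1")
      case True
      then show thesis using that[of i] Suc.prems zs by (auto simp: nth_append)
    next
      case False
      then have "isl (vs ! (i - (n - 1)))" "i - (n - 1) < length vs"
        using Suc.prems zs by (auto simp: nth_append)
      then have "isl (N k vs)" using zs by (auto simp: isl_nested_bracket)
      then show thesis using that[of "n - 1"] True zs by (auto simp: nth_append)
    qed
    have "M (us @ [N k vs]) = M ((us @ [N k vs])[j := Inr (\<mu> l)])"
      unfolding M_def using True i' Suc.prems zs
      by (intro mixed_bracket_replace[of _ _ _ i']) (auto simp: nth_append M_def)
    then show ?thesis using zs True by (simp add: list_update_append)
  next
    case False
    define j' where "j' = j - (n - 1)"
    have j': "j' < length vs" "vs ! j' = Inl l"
      using False Suc.prems zs by (auto simp: j'_def nth_append)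
    let ?vs = "vs[j' := Inr (\<mu> l)]"
    have upd: "N (Suc k) (zs[j := Inr (\<mu> l)]) = M (us @ [N k ?vs])"
      using False zs by (simp add: list_update_append j'_def)
    show ?thesis
    proof (cases "\<exists>i'<length vs. i' \<noteq> j' \<and> isl (vs ! i')")
      case True
      then have "N k vs = N k ?vs"
        using Suc.IH[OF zs(3) j'] by blast
      then show ?thesis unfolding upd using zs by simp
    next
      case only_j': False
      have i: "i < n - 1"
      proof (rule ccontr)
        assume i: "\<not> i < n - 1"
        have "i - (n - 1) < length vs"
          using Suc.prems(4) zs by simp
        moreover have "i - (n - 1) \<noteq> j'"
          using i False Suc.prems(5) unfolding j'_def by linarith
        moreover have "isl (vs ! (i - (n - 1)))"
          using i Suc.prems(6) zs by (simp add: nth_append)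
        ultimately show False using only_j' by blast
      qed
      have "isl (N k vs)"
        using zs j' by (metis isl_nested_bracket nth_mem sum.disc(1))
      then obtain a where a: "N k vs = Inl a" by (auto simp: isl_def)
      have "\<not> isl z" if "z \<in> set ?vs" for z
      proof -
        obtain i where "i < length vs" "z = ?vs ! i"
          using \<open>z \<in> set ?vs\<close> by (metis in_set_conv_nth length_list_update)
        then show ?thesis using only_j' by (cases "i = j'") auto
      qed
      then have "\<not> isl (N k ?vs)"
        using zs by (auto simp: isl_nested_bracket)
      then obtain b where b: "N k ?vs = Inr b" by (cases "N k ?vs") auto
      \<comment> \<open>Applying \<open>\<mu>\<close> to all \<open>L\<close>-entries erases the
        difference between \<open>vs\<close> and \<open>?vs\<close>, so the new inner value is the
        image of the old one.\<close>
      have hom: "case_sum \<mu> id (N k ws) = nested_bracket n k brP (map (case_sum \<mu> id) ws)"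
        if "length ws = k * (n - 1) + 1" for ws
        using assms(1) that hom_mixed_bracket by (intro nested_bracket_map) (auto simp: M_def)
      have "map (case_sum \<mu> id) ?vs = map (case_sum \<mu> id) vs"
        using j' by (auto simp: map_update list_update_same_conv)
      then have "case_sum \<mu> id (N k ?vs) = case_sum \<mu> id (N k vs)"
        using zs by (simp add: hom)
      then have b: "N k ?vs = Inr (\<mu> a)" by (simp add: a b)
      \<comment> \<open>The entry at \<open>i\<close> lies among \<open>us\<close>, so the outer
        bracket still has an \<open>L\<close>-entry after the replacement.\<close>
      have "M (us @ [Inl a]) = M ((us @ [Inl a])[n - 1 := Inr (\<mu> a)])"
        unfolding M_def using Suc.prems zs i
        by (intro mixed_bracket_replace[of _ _ _ i]) (auto simp: nth_append)
      then show ?thesis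
        unfolding upd using zs a b by (simp add: list_update_append)
    qed
  qed
qed

end

text \<open>Single replacements suffice: (CM2) follows by replacing the entries in \<open>I\<close>
  one after another, and (CM3) is one replacement in a mixed list.\<close>

lemma leibniz_crossed_module_if_mixed_bracket:
  fixes brL :: "'l::ab_group_add list \<Rightarrow> 'l" and brP :: "'p::ab_group_add list \<Rightarrow> 'p"
  defines "M \<equiv> mixed_bracket brL brP"
  assumes action: "leibniz_action n scaleL brL scaleP brP act"
    and linear: "Vector_Spaces.linear scaleL scaleP \<mu>"
    and hom: "\<And>zs. length zs = n \<Longrightarrow> case_sum \<mu> id (M act zs) = brP (map (case_sum \<mu> id) zs)"
    and replace: "\<And>zs i j l. length zs = n \<Longrightarrow> j < n \<Longrightarrow> zs ! j = Inl l \<Longrightarrow>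
      i < n \<Longrightarrow> i \<noteq> j \<Longrightarrow> isl (zs ! i) \<Longrightarrow> M act zs = M act (zs[j := Inr (\<mu> l)])"
  shows "leibniz_crossed_module n scaleL brL scaleP brP act \<mu>"
proof -
  interpret leibniz_action n scaleL brL scaleP brP act by fact
  show ?thesis
  proof (intro leibniz_crossed_module.intro leibniz_hom.intro leibniz_hom_axioms.intro
      leibniz_crossed_module_axioms.intro action linear
      L.leibniz_algebra_axioms P.leibniz_algebra_axioms)
    show "\<mu> (brL xs) = brP (map \<mu> xs)" if "length xs = n" for xs
      using hom[of "map Inl xs"] that by (simp add: M_def mixed_bracket_Inl comp_def)
    show "\<mu> (act zs) = brP (map (case_sum \<mu> id) zs)" if "length zs = n" "mixed zs" for zs
      using hom[of zs] that by (simp add: M_def mixed_bracket_mixed)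
    show "brL ls = act (replace_at \<mu> I ls)"
      if len: "length ls = n" and card: "1 \<le> i" "i \<le> n - 1" "card I = i" and I: "I \<subseteq> {..<n}"
      for ls i I
    proof -
      have fin: "finite I" using I finite_subset by blast
      have less: "card I < n" using card by auto
      have "M act (replace_at \<mu> I ls) = M act (map Inl ls)"
        using fin I less
      proof (induction I)
        case empty
        have "replace_at \<mu> {} ls = map Inl ls"
          by (intro nth_equalityI) (auto simp: replace_at_def)
        then show ?case by simp
      next
        case (insert j I)
        \<comment> \<open>Since fewer than \<open>n\<close> entries are replaced, an untouched
          \<open>L\<close>-entry is available at every stage.\<close>
        obtain i where i: "i < n" "i \<notin> insert j I"
        proof -
          have "insert j I \<noteq> {..<n}" using insert.prems by auto
          then show thesis using that insert.prems by blast
        qed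
        have "replace_at \<mu> (insert j I) ls = (replace_at \<mu> I ls)[j := Inr (\<mu> (ls ! j))]"
          using insert.hyps insert.prems len
          by (intro nth_equalityI) (auto simp: replace_at_def nth_list_update)
        moreover have "M act (replace_at \<mu> I ls) = M act \<dots>"
          using insert.hyps insert.prems i len
          by (intro replace[of _ _ _ i]) (auto simp: replace_at_def)
        ultimately show ?case using insert.IH insert.prems insert.hyps by simp
      qed
      moreover have "mixed (replace_at \<mu> I ls)"
      proof -
        have "I \<noteq> {}" "I \<noteq> {..<n}" using card less by auto
        then obtain i j where "i \<in> I" "j < n" "j \<notin> I" using I by blast
        moreover from this have "i < n" using I by blast
        ultimately have "replace_at \<mu> I ls ! i = Inr (\<mu> (ls ! i))"
          "replace_at \<mu> I ls ! j = Inl (ls ! j)"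
          using len by (simp_all add: replace_at_def)
        moreover have "length (replace_at \<mu> I ls) = n"
          using len by (simp add: replace_at_def)
        ultimately show ?thesis
          using \<open>i < n\<close> \<open>j < n\<close> unfolding mixed_def by (metis nth_mem sum.disc)
      qed
      ultimately show ?thesis
        by (simp add: M_def mixed_bracket_mixed mixed_bracket_Inl)
    qed
    show "act zs = act (zs[j := Inr (\<mu> l)])"
      if len: "length zs = n" and mixed: "mixed zs" and two: "2 \<le> length (filter isl zs)"
        and j: "j < n" "zs ! j = Inl l" for zs j l
    proof -
      obtain i where i: "i < n" "i \<noteq> j" "isl (zs ! i)"
        using two two_isl_iff[of j zs] len j by auto
      then have "mixed (zs[j := Inr (\<mu> l)])"
        using len j by (intro mixed_replace) auto
      then show ?thesis
        using replace[OF len j i] mixed by (simp add: M_def mixed_bracket_mixed)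
    qed
  qed
qed

theorem proposition4p5:
  fixes n k p :: nat
    and scaleL :: "'k::field \<Rightarrow> 'l::ab_group_add \<Rightarrow> 'l" and brL :: "'l list \<Rightarrow> 'l"
    and scaleP :: "'k \<Rightarrow> 'p::ab_group_add \<Rightarrow> 'p" and brP :: "'p list \<Rightarrow> 'p"
    and act :: "('l + 'p) list \<Rightarrow> 'l"
    and \<mu> :: "'l \<Rightarrow> 'p"
  assumes "n \<ge> 2" and "k \<ge> 1" and "p = k * (n - 1) + 1"
    and "leibniz_crossed_module n scaleL brL scaleP brP act \<mu>"
  shows "leibniz_crossed_module p
           scaleL (nested_bracket n k brL)
           scaleP (nested_bracket n k brP)
           (induced_action n k brL brP act) \<mu>"
proof -
  interpret leibniz_crossed_module n scaleL brL scaleP brP act \<mu> by fact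
  let ?M = "mixed_bracket brL brP act"
  have tagged: "tagged_leibniz n scaleL scaleP ?M"
    using assms(1) by (rule tagged_leibniz_mixed_bracket)
  \<comment> \<open>This identity reduces every axiom for the induced data to a statement about the
    nested bracket of \<open>?M\<close>.\<close>
  have bracket: "mixed_bracket (nested_bracket n k brL) (nested_bracket n k brP)
      (induced_action n k brL brP act) zs = nested_bracket n k ?M zs" if "length zs = p" for zs
    using mixed_bracket_induced_action[OF tagged] that assms(3) by simp
  show ?thesis
  proof (rule leibniz_crossed_module_if_mixed_bracket)
    show "leibniz_action p scaleL (nested_bracket n k brL) scaleP (nested_bracket n k brP)
        (induced_action n k brL brP act)"
      using tagged_leibniz.tagged_leibniz_nested_bracket[OF tagged assms(2,3)] bracket
      by (intro leibniz_action_if_tagged_leibniz) auto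
    show "case_sum \<mu> id (mixed_bracket (nested_bracket n k brL) (nested_bracket n k brP)
        (induced_action n k brL brP act) zs) = nested_bracket n k brP (map (case_sum \<mu> id) zs)"
      if "length zs = p" for zs
      unfolding bracket[OF that] using assms(1,3) that hom_mixed_bracket
      by (intro nested_bracket_map) auto
    show "mixed_bracket (nested_bracket n k brL) (nested_bracket n k brP)
        (induced_action n k brL brP act) zs =
      mixed_bracket (nested_bracket n k brL) (nested_bracket n k brP)
        (induced_action n k brL brP act) (zs[j := Inr (\<mu> l)])"
      if "length zs = p" "j < p" "zs ! j = Inl l" "i < p" "i \<noteq> j" "isl (zs ! i)" for zs i j l
      using nested_mixed_bracket_replace[OF assms(1), of zs k j l i] that assms(3)
      by (simp add: bracket)
  qed (rule linear_hom)
qed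

end
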